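(* For a generalized network code $(\mathcal{C},F)$, $d_0^{\min}\ge d_2^{\min}$ and $d_1^{\min}\ge d_2^{\min}$. When $F$ is error-linear, $d_0^{\min}=d_1^{\min}=d_2^{\min}$.
   Context: A generalized network channel consists of a set $\mathcal{C}$ of codewords, a set $\mathcal{E}$ of errors with a distinguished element $0$ (the zero error), an output set $\mathcal{Y}$, a weight $w:\mathcal{E}\to\mathbb{Z}_{\ge 0}$ with $w(z)=0$ if and only if $z=0$, and a transfer function $F:\mathcal{C}\times\mathcal{E}\to\mathcal{Y}$ such that $F(x,0)\ne F(x',0)$ whenever $x\neq x'$ in $\mathcal{C}$. The sets are otherwise arbitrary. The pair $(\mathcal{C},F)$ is called a generalized network code; $|\mathcal{C}|\ge 2$ is assumed. The channel $F$ is called error-linear if: (i) $\mathcal{E}$ is a (not necessarily abelian) group with operation $\circ$ and identity $0$; (ii) $\mathcal{Y}$ is an abelian group with operation $\oplus$ and identity $0$; (iii) $F(x,z)=f(x)\oplus h(z)$ for some function $f:\mathcal{C}\to\mathcal{Y}$ and some group homomorphism $h:\mathcal{E}\to\mathcal{Y}$; (iv) $w(z\circ z')\le w(z)+w(z')$ for all $z,z'\in\mathcal{E}$; (v) $w(z^{-1})=w(z)$ for all $z\in\mathcal{E}$; (vi) for every $z\in\mathcal{E}$ and integers $c_1,c_2\ge 0$ with $c_1+c_2=w(z)$ there exist $z_1,z_2\in\mathcal{E}$ with $w(z_1)=c_1$, $w(z_2)=c_2$ and $z_1\circ z_2=z$. For $x\in\mathcal{C}$ and an integer $c\ge 0$,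 the decoding ball is $\Phi(x,c)=\{F(x,z): z\in\mathcal{E},\ w(z)\le c\}$. For $x_1,x_2\in\mathcal{C}$ (all $c$'s are nonnegative integers, and a minimum over the empty set is $+\infty$): $D_0(x_1,x_2)=\min\{c_1+c_2 : |c_1-c_2|\le 1,\ \Phi(x_1,c_1)\cap\Phi(x_2,c_2)\ne\emptyset\}$; $D_1(x_1,x_2)=\min\{c : \Phi(x_1,0)\cap\Phi(x_2,c)\neq\emptyset\}$; $D_2(x_1,x_2)=\min\{c_1+c_2 : \Phi(x_1,c_1)\cap\Phi(x_2,c_2)\neq\emptyset\}$; and $d_i^{\min}=\min_{x_1,x_2\in\mathcal{C},\,x_1\ne x_2}D_i(x_1,x_2)$ for $i=0,1,2$. *)

theory Defs
  imports "HOL-Algebra.Group" "HOL-Library.Extended_Nat"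
begin

text \<open>
  Codewords, errors and outputs are carrier sets \<open>C\<close>, \<open>E\<close>, \<open>Y\<close>; \<open>e0\<close> is the zero error.
  The functions \<open>w\<close> and \<open>F\<close> are total in HOL and unconstrained outside these sets.
\<close>

locale generalized_network_code =
  fixes C :: "'c set" and E :: "'e set" and e0 :: 'e and Y :: "'y set"
    and w :: "'e \<Rightarrow> nat" and F :: "'c \<Rightarrow> 'e \<Rightarrow> 'y"
  assumes zero_error: "e0 \<in> E"
    and weight_eq_0_iff: "\<And>z. z \<in> E \<Longrightarrow> w z = 0 \<longleftrightarrow> z = e0"
    and transfer_closed: "\<And>x z. x \<in> C \<Longrightarrow> z \<in> E \<Longrightarrow> F x z \<in> Y"
    and zero_error_inj: "\<And>x x'. x \<in> C \<Longrightarrow> x' \<in> C \<Longrightarrow> x \<noteq> x' \<Longrightarrow> F x e0 \<noteq> F x' e0"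
    and two_codewords: "\<exists>x\<in>C. \<exists>x'\<in>C. x \<noteq> x'"

text \<open>
  Both group laws are written multiplicatively, as in HOL-Algebra: \<open>G\<close> carries the operation
  on errors, \<open>H\<close> the (commutative) operation on outputs.
\<close>

definition error_linear ::
  "'c set \<Rightarrow> 'e set \<Rightarrow> 'e \<Rightarrow> 'y set \<Rightarrow> ('e \<Rightarrow> nat) \<Rightarrow> ('c \<Rightarrow> 'e \<Rightarrow> 'y) \<Rightarrow> bool" where
  "error_linear C E e0 Y w F \<longleftrightarrow>
    (\<exists>(G :: 'e monoid) (H :: 'y monoid) f h.
      group G \<and> carrier G = E \<and> \<one>\<^bsub>G\<^esub> = e0 \<and>
      comm_group H \<and> carrier H = Y \<and>
      (\<forall>x\<in>C. f x \<in> Y) \<and> h \<in> hom G H \<and>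
      (\<forall>x\<in>C. \<forall>z\<in>E. F x z = f x \<otimes>\<^bsub>H\<^esub> h z) \<and>
      (\<forall>z\<in>E. \<forall>z'\<in>E. w (z \<otimes>\<^bsub>G\<^esub> z') \<le> w z + w z') \<and>
      (\<forall>z\<in>E. w (inv\<^bsub>G\<^esub> z) = w z) \<and>
      (\<forall>z\<in>E. \<forall>c1 c2. c1 + c2 = w z \<longrightarrow>
        (\<exists>z1\<in>E. \<exists>z2\<in>E. w z1 = c1 \<and> w z2 = c2 \<and> z1 \<otimes>\<^bsub>G\<^esub> z2 = z)))"

definition decoding_ball ::
  "'e set \<Rightarrow> ('e \<Rightarrow> nat) \<Rightarrow> ('c \<Rightarrow> 'e \<Rightarrow> 'y) \<Rightarrow> 'c \<Rightarrow> nat \<Rightarrow> 'y set" where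
  "decoding_ball E w F x c = {F x z | z. z \<in> E \<and> w z \<le> c}"

text \<open>
  Minima are taken in \<^typ>\<open>enat\<close> as infima: the infimum of a nonempty set is attained, and that
  of the empty set is \<open>\<infinity>\<close>.
\<close>

definition D0 ::
  "'e set \<Rightarrow> ('e \<Rightarrow> nat) \<Rightarrow> ('c \<Rightarrow> 'e \<Rightarrow> 'y) \<Rightarrow> 'c \<Rightarrow> 'c \<Rightarrow> enat" where
  "D0 E w F x1 x2 = Inf {enat (c1 + c2) | c1 c2. \<bar>int c1 - int c2\<bar> \<le> 1 \<and>
     decoding_ball E w F x1 c1 \<inter> decoding_ball E w F x2 c2 \<noteq> {}}"

definition D1 ::
  "'e set \<Rightarrow> ('e \<Rightarrow> nat) \<Rightarrow> ('c \<Rightarrow> 'e \<Rightarrow> 'y) \<Rightarrow> 'c \<Rightarrow> 'c \<Rightarrow> enat" where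
  "D1 E w F x1 x2 = Inf {enat c | c.
     decoding_ball E w F x1 0 \<inter> decoding_ball E w F x2 c \<noteq> {}}"

definition D2 ::
  "'e set \<Rightarrow> ('e \<Rightarrow> nat) \<Rightarrow> ('c \<Rightarrow> 'e \<Rightarrow> 'y) \<Rightarrow> 'c \<Rightarrow> 'c \<Rightarrow> enat" where
  "D2 E w F x1 x2 = Inf {enat (c1 + c2) | c1 c2.
     decoding_ball E w F x1 c1 \<inter> decoding_ball E w F x2 c2 \<noteq> {}}"

definition min_distance :: "'c set \<Rightarrow> ('c \<Rightarrow> 'c \<Rightarrow> enat) \<Rightarrow> enat" where
  "min_distance C D = Inf {D x1 x2 | x1 x2. x1 \<in> C \<and> x2 \<in> C \<and> x1 \<noteq> x2}"

end

(*
Only the total radius matters in an error-linear channel: if f(x1) + h(z1) = f(x2) + h(z2), then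
f(x1) = f(x2) + h(z) with z = z2 z1^-1 of weight at most w(z1) + w(z2). Splitting z = uv with
w(u) = b and w(v) = a and moving h(v) to the left shows that the balls of radii a and b meet
for every decomposition a + b = w(z). The choice a = 0 bounds D1, a balanced one bounds D0.
*)
theory Submission
  imports Defs
begin

text \<open>All comparisons of minimum distances are made pair by pair; this passes them on to the
  minima.\<close>

lemma min_distance_mono:
  assumes "\<And>x1 x2. x1 \<in> C \<Longrightarrow> x2 \<in> C \<Longrightarrow> D x1 x2 \<le> D' x1 x2"
  shows "min_distance C D \<le> min_distance C D'"
  unfolding min_distance_def using assms by (intro Inf_mono) blast

lemma D2_le_D0: "D2 E w F x1 x2 \<le> D0 E w F x1 x2"
  unfolding D0_def D2_def by (intro Inf_superset_mono) blast

text \<open>Radii \<open>0\<close> and \<open>c\<close> are among those that \<open>D2\<close>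
  ranges over, with total \<open>c\<close>.\<close>

lemma D2_le_D1: "D2 E w F x1 x2 \<le> D1 E w F x1 x2"
  unfolding D1_def D2_def by (intro Inf_superset_mono) force

text \<open>The total \<open>n\<close> may be smaller than \<open>c1 + c2\<close>, because the
  splitting axiom decomposes only the exact weight of an error, here \<open>w z\<close>. It is fixed
  before \<open>a\<close> and \<open>b\<close>, so that every split of it is available
  afterwards.\<close>

lemma error_linear_balls_meet:
  fixes C :: "'c set" and E :: "'e set" and Y :: "'y set"
  assumes "error_linear C E e0 Y w F" and x: "x1 \<in> C" "x2 \<in> C"
    and meet: "decoding_ball E w F x1 c1 \<inter> decoding_ball E w F x2 c2 \<noteq> {}"
  obtains n where "n \<le> c1 + c2"
    and "\<And>a b. a + b = n \<Longrightarrow> decoding_ball E w F x1 a \<inter> decoding_ball E w F x2 b \<noteq> {}"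
proof -
  obtain G :: "'e monoid" and H :: "'y monoid" and f h where
    "group G" and E: "carrier G = E" and "comm_group H" and Y: "carrier H = Y"
    and f: "\<And>x. x \<in> C \<Longrightarrow> f x \<in> Y" and h: "h \<in> hom G H"
    and F: "\<And>x z. x \<in> C \<Longrightarrow> z \<in> E \<Longrightarrow> F x z = f x \<otimes>\<^bsub>H\<^esub> h z"
    and tri: "\<And>z z'. z \<in> E \<Longrightarrow> z' \<in> E \<Longrightarrow> w (z \<otimes>\<^bsub>G\<^esub> z') \<le> w z + w z'"
    and sym: "\<And>z. z \<in> E \<Longrightarrow> w (inv\<^bsub>G\<^esub> z) = w z"
    and split: "\<And>z c1 c2. z \<in> E \<Longrightarrow> c1 + c2 = w z \<Longrightarrow>
        \<exists>z1\<in>E. \<exists>z2\<in>E. w z1 = c1 \<and> w z2 = c2 \<and> z1 \<otimes>\<^bsub>G\<^esub> z2 = z"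
    using assms(1) unfolding error_linear_def
    by (elim exE conjE) (rule that, (assumption | blast)+)
  interpret G: group G by fact
  interpret H: comm_group H by fact
  interpret group_hom G H h
    by unfold_locales (rule h)
  have fx: "f x1 \<in> carrier H" "f x2 \<in> carrier H"
    using f x Y by auto
  obtain z1 z2 where z: "z1 \<in> E" "z2 \<in> E" "w z1 \<le> c1" "w z2 \<le> c2" "F x1 z1 = F x2 z2"
    using meet unfolding decoding_ball_def by auto
  define z where "z = z2 \<otimes>\<^bsub>G\<^esub> inv\<^bsub>G\<^esub> z1"
  have zE: "z \<in> E"
    using z E by (auto simp: z_def)
  have "f x1 \<otimes>\<^bsub>H\<^esub> h z1 = f x2 \<otimes>\<^bsub>H\<^esub> h z2"
    using z F x by simp
  then have fz: "f x1 = f x2 \<otimes>\<^bsub>H\<^esub> h z"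
    using z(1,2) fx by (simp add: z_def H.inv_solve_right flip: E H.m_assoc)
  show thesis
  proof
    show "w z \<le> c1 + c2"
      using tri[of z2 "inv\<^bsub>G\<^esub> z1"] sym[of z1] z E G.inv_closed[of z1] by (auto simp: z_def)
  next
    fix a b assume "a + b = w z"
    \<comment> \<open>The weights are requested in the order \<open>b\<close>, \<open>a\<close>: the
      left factor \<open>u\<close> stays with \<open>x2\<close>, while the right factor
      \<open>v\<close> comes last in the product below and can be cancelled there by its
      inverse.\<close>
    then obtain u v where uv: "u \<in> E" "v \<in> E" "w u = b" "w v = a" "u \<otimes>\<^bsub>G\<^esub> v = z"
      using split[of z b a] zE by (auto simp: add.commute)
    have "f x1 = f x2 \<otimes>\<^bsub>H\<^esub> h u \<otimes>\<^bsub>H\<^esub> h v"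
      using fz uv(1,2) fx by (simp add: H.m_assoc flip: uv(5) E)
    \<comment> \<open>This is the common point of the two balls. Inversion preserves weight, so the
      error on the \<open>x1\<close> side still has weight \<open>a\<close>.\<close>
    then have "F x1 (inv\<^bsub>G\<^esub> v) = F x2 u"
      using F x fx uv(1,2) by (simp add: H.m_assoc flip: E)
    moreover have "F x1 (inv\<^bsub>G\<^esub> v) \<in> decoding_ball E w F x1 a"
      using sym[of v] uv E G.inv_closed[of v] by (auto simp: decoding_ball_def)
    moreover have "F x2 u \<in> decoding_ball E w F x2 b"
      using uv by (auto simp: decoding_ball_def)
    ultimately show "decoding_ball E w F x1 a \<inter> decoding_ball E w F x2 b \<noteq> {}"
      by auto
  qed
qed

lemma error_linear_D0_le_D2:
  assumes "error_linear C E e0 Y w F" "x1 \<in> C" "x2 \<in> C"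
  shows "D0 E w F x1 x2 \<le> D2 E w F x1 x2"
  unfolding D2_def
\<comment> \<open>It suffices to bound each candidate of \<open>D2\<close>; if no balls meet,
  \<open>D2\<close> is infinite and nothing remains to be shown.\<close>
proof (rule Inf_greatest, clarify)
  fix c1 c2
  assume "decoding_ball E w F x1 c1 \<inter> decoding_ball E w F x2 c2 \<noteq> {}"
  from error_linear_balls_meet[OF assms this] obtain n where n: "n \<le> c1 + c2"
    and meet: "\<And>a b. a + b = n \<Longrightarrow> decoding_ball E w F x1 a \<inter> decoding_ball E w F x2 b \<noteq> {}"
    by blast
  \<comment> \<open>The two halves differ by 0 or 1 according to the parity of \<open>n\<close>,
    which is exactly the imbalance that \<open>D0\<close> tolerates.\<close>
  have "n div 2 + (n - n div 2) = n" "\<bar>int (n div 2) - int (n - n div 2)\<bar> \<le> 1"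
    by linarith+
  then have "D0 E w F x1 x2 \<le> enat n"
    unfolding D0_def using meet[of "n div 2" "n - n div 2"]
    by (intro Inf_lower CollectI exI[of _ "n div 2"] exI[of _ "n - n div 2"]) simp
  then show "D0 E w F x1 x2 \<le> enat (c1 + c2)"
    using n by (meson enat_ord_simps(1) order_trans)
qed

lemma error_linear_D1_le_D2:
  assumes "error_linear C E e0 Y w F" "x1 \<in> C" "x2 \<in> C"
  shows "D1 E w F x1 x2 \<le> D2 E w F x1 x2"
  unfolding D2_def
proof (rule Inf_greatest, clarify)
  fix c1 c2
  assume "decoding_ball E w F x1 c1 \<inter> decoding_ball E w F x2 c2 \<noteq> {}"
  from error_linear_balls_meet[OF assms this] obtain n where n: "n \<le> c1 + c2"
    and meet: "\<And>a b. a + b = n \<Longrightarrow> decoding_ball E w F x1 a \<inter> decoding_ball E w F x2 b \<noteq> {}"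
    by blast
  \<comment> \<open>The extreme split puts the whole weight on the \<open>x2\<close> side, as the
    radius 0 around \<open>x1\<close> in \<open>D1\<close> demands.\<close>
  have "D1 E w F x1 x2 \<le> enat n"
    unfolding D1_def using meet[of 0 n] by (intro Inf_lower) auto
  then show "D1 E w F x1 x2 \<le> enat (c1 + c2)"
    using n by (meson enat_ord_simps(1) order_trans)
qed

theorem corollary5p6:
  fixes C :: "'c set" and E :: "'e set" and e0 :: 'e and Y :: "'y set"
    and w :: "'e \<Rightarrow> nat" and F :: "'c \<Rightarrow> 'e \<Rightarrow> 'y"
  assumes "generalized_network_code C E e0 Y w F"
  shows "min_distance C (D0 E w F) \<ge> min_distance C (D2 E w F)
    \<and> min_distance C (D1 E w F) \<ge> min_distance C (D2 E w F)
    \<and> (error_linear C E e0 Y w F \<longrightarrow>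
         min_distance C (D0 E w F) = min_distance C (D1 E w F) \<and>
         min_distance C (D1 E w F) = min_distance C (D2 E w F))"
proof -
  have "min_distance C (D2 E w F) \<le> min_distance C (D0 E w F)"
    and "min_distance C (D2 E w F) \<le> min_distance C (D1 E w F)"
    by (intro min_distance_mono D2_le_D0 D2_le_D1)+
  \<comment> \<open>In the error-linear case both reverse inequalities hold, so \<open>D0\<close>
    and \<open>D1\<close> each have the same minimum as \<open>D2\<close>.\<close>
  moreover have "min_distance C (D0 E w F) \<le> min_distance C (D2 E w F)"
    and "min_distance C (D1 E w F) \<le> min_distance C (D2 E w F)"
    if "error_linear C E e0 Y w F"
    using that by (auto intro!: min_distance_mono error_linear_D0_le_D2 error_linear_D1_le_D2)
  ultimately show ?thesis
    by (simp add: order_antisym)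
qed

end
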